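(* Let $X$ be a Banach space, let $\delta\in(0,1]$, and let $\mathcal S_\delta=\{\mathcal S_\delta(t)\}_{t\ge 0}\subset\mathcal L(X)$ be a $C_0$--$\delta$--semigroup on $X$ with $\delta$-generator $\mathcal A_\delta$. Let $\mathcal T(s):=\mathcal S_\delta((\delta s)^{1/\delta})$, $s\ge0$, which is a classical $C_0$-semigroup on $X$, and let $\mathcal B$ be its (classical) generator. Then $$D(\mathcal A_\delta)=D(\mathcal B),\qquad \mathcal A_\delta x=\mathcal B x\quad\text{for all }x\in D(\mathcal A_\delta).$$
   Context: $\mathcal L(X)$ denotes the bounded linear operators on $X$. A family $\{\mathcal S_\delta(t)\}_{t\ge0}\subset\mathcal L(X)$ is a conformable $\delta$--semigroup if $\mathcal S_\delta(0)=\mathrm{Id}$ and $\mathcal S_\delta((r+q)^{1/\delta})=\mathcal S_\delta(r^{1/\delta})\,\mathcal S_\delta(q^{1/\delta})$ for all $r,q\ge 0$. It is a $C_0$--$\delta$--semigroup if in addition $\lim_{t\to0^+}\mathcal S_\delta(t)x=x$ for all $x\in X$. The conformable derivative of order $\delta$ of a function $v$ at $t>0$ is $\mathcal D_t^\delta v(t)=\lim_{h\to0}\frac{v(t+h\,t^{1-\delta})-v(t)}{h}$, when the limit exists (for $X$-valued $v$, the limit is in the norm of $X$). The $\delta$-generator of $\mathcal S_\delta$ is the operator $\mathcal A_\delta$ with domain $D(\mathcal A_\delta)=\{x\in X:\ \lim_{t\to0^+}\mathcal D_t^\delta\mathcal S_\delta(t)x\text{ exists}\}$ and $\mathcal A_\delta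 x=\lim_{t\to0^+}\mathcal D_t^\delta\mathcal S_\delta(t)x$; existence of the limit includes that $\mathcal D_t^\delta\mathcal S_\delta(t)x$ exists for all sufficiently small $t>0$. *)

theory Defs
  imports "HOL-Analysis.Analysis"
begin

text \<open>
  Operator families are functions \<open>real \<Rightarrow> 'a \<Rightarrow>\<^sub>L 'a\<close>; only their values on \<open>{0..}\<close> are
  constrained and used. Unbounded operators are given by a domain together with a total
  function whose values outside the domain are irrelevant.
\<close>

definition conf_semigroup :: "real \<Rightarrow> (real \<Rightarrow> 'a::real_normed_vector \<Rightarrow>\<^sub>L 'a) \<Rightarrow> bool" where
  "conf_semigroup \<delta> S \<longleftrightarrow>
     S 0 = id_blinfun \<and>
     (\<forall>r\<ge>0. \<forall>q\<ge>0. S ((r + q) powr (1 / \<delta>)) =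
        blinfun_compose (S (r powr (1 / \<delta>))) (S (q powr (1 / \<delta>))))"

definition C0_conf_semigroup :: "real \<Rightarrow> (real \<Rightarrow> 'a::real_normed_vector \<Rightarrow>\<^sub>L 'a) \<Rightarrow> bool" where
  "C0_conf_semigroup \<delta> S \<longleftrightarrow>
     conf_semigroup \<delta> S \<and>
     (\<forall>x. ((\<lambda>t. blinfun_apply (S t) x) \<longlongrightarrow> x) (at_right 0))"

text \<open>The conformable derivative, meaningful for \<open>t > 0\<close> only.\<close>

definition has_conf_derivative ::
  "real \<Rightarrow> (real \<Rightarrow> 'a::real_normed_vector) \<Rightarrow> 'a \<Rightarrow> real \<Rightarrow> bool" where
  "has_conf_derivative \<delta> v d t \<longleftrightarrow>
     ((\<lambda>h. (v (t + h * t powr (1 - \<delta>)) - v t) /\<^sub>R h) \<longlongrightarrow> d) (at 0)"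

definition conf_differentiable ::
  "real \<Rightarrow> (real \<Rightarrow> 'a::real_normed_vector) \<Rightarrow> real \<Rightarrow> bool" where
  "conf_differentiable \<delta> v t \<longleftrightarrow> (\<exists>d. has_conf_derivative \<delta> v d t)"

definition conf_deriv ::
  "real \<Rightarrow> (real \<Rightarrow> 'a::real_normed_vector) \<Rightarrow> real \<Rightarrow> 'a" where
  "conf_deriv \<delta> v t = (THE d. has_conf_derivative \<delta> v d t)"

text \<open>
  Since \<^const>\<open>conf_deriv\<close> is total, existence of the derivative near \<open>0\<close> is required separately.
\<close>

definition conf_generator_dom ::
  "real \<Rightarrow> (real \<Rightarrow> 'a::real_normed_vector \<Rightarrow>\<^sub>L 'a) \<Rightarrow> 'a set" where
  "conf_generator_dom \<delta> S =
     {x. (\<forall>\<^sub>F t in at_right 0. conf_differentiable \<delta> (\<lambda>u. blinfun_apply (S u) x) t) \<and>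
         (\<exists>y. ((\<lambda>t. conf_deriv \<delta> (\<lambda>u. blinfun_apply (S u) x) t) \<longlongrightarrow> y) (at_right 0))}"

definition conf_generator ::
  "real \<Rightarrow> (real \<Rightarrow> 'a::real_normed_vector \<Rightarrow>\<^sub>L 'a) \<Rightarrow> 'a \<Rightarrow> 'a" where
  "conf_generator \<delta> S x =
     Lim (at_right 0) (\<lambda>t. conf_deriv \<delta> (\<lambda>u. blinfun_apply (S u) x) t)"

definition C0_semigroup :: "(real \<Rightarrow> 'a::real_normed_vector \<Rightarrow>\<^sub>L 'a) \<Rightarrow> bool" where
  "C0_semigroup T \<longleftrightarrow>
     T 0 = id_blinfun \<and>
     (\<forall>r\<ge>0. \<forall>s\<ge>0. T (r + s) = blinfun_compose (T r) (T s)) \<and>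
     (\<forall>x. ((\<lambda>s. blinfun_apply (T s) x) \<longlongrightarrow> x) (at_right 0))"

definition generator_dom :: "(real \<Rightarrow> 'a::real_normed_vector \<Rightarrow>\<^sub>L 'a) \<Rightarrow> 'a set" where
  "generator_dom T =
     {x. \<exists>y. ((\<lambda>s. (blinfun_apply (T s) x - x) /\<^sub>R s) \<longlongrightarrow> y) (at_right 0)}"

definition generator :: "(real \<Rightarrow> 'a::real_normed_vector \<Rightarrow>\<^sub>L 'a) \<Rightarrow> 'a \<Rightarrow> 'a" where
  "generator T x = Lim (at_right 0) (\<lambda>s. (blinfun_apply (T s) x - x) /\<^sub>R s)"

end

theory Submission
  imports Defs
begin

text \<open>
  By the chain rule, the conformable derivative of \<open>u \<mapsto> S u x\<close> at \<open>t > 0\<close> is the ordinary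
  derivative of \<open>r \<mapsto> T r x\<close> at \<open>t powr \<delta> / \<delta>\<close>. So the claim is that the orbit has a right
  derivative \<open>y\<close> at \<open>0\<close> iff it is differentiable on some \<open>{0<..<b}\<close> with derivative tending
  to \<open>y\<close>. The backward direction is the mean value inequality. For the forward one the orbit has
  derivative \<open>T s y\<close> at \<open>s > 0\<close>; its left derivative needs local boundedness of \<open>T\<close>, hence the
  uniform boundedness principle, which is derived from Baire's theorem.
\<close>

section \<open>One-sided derivatives\<close>

text \<open>Generators and conformable derivatives are limits of quotients, whereas the mean value
  inequality and the chain rule speak of \<open>has_vector_derivative\<close>. The set
  \<open>A\<close> stays arbitrary so that one-sided derivatives are covered too.\<close>

lemma has_vector_derivative_iff_quotient:
  fixes f :: "real \<Rightarrow> 'a::real_normed_vector"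
  shows "(f has_vector_derivative d) (at x within A) \<longleftrightarrow>
    ((\<lambda>y. (f y - f x) /\<^sub>R (y - x)) \<longlongrightarrow> d) (at x within A)"
proof -
  have "norm (f y - f x - (y - x) *\<^sub>R d) / norm (y - x) = norm ((f y - f x) /\<^sub>R (y - x) - d)"
    if "y \<noteq> x" for y
  proof -
    have "f y - f x - (y - x) *\<^sub>R d = (y - x) *\<^sub>R ((f y - f x) /\<^sub>R (y - x) - d)"
      using that by (simp add: scaleR_diff_right)
    then show ?thesis
      using that by simp
  qed
  then have "((\<lambda>y. norm (f y - f x - (y - x) *\<^sub>R d) / norm (y - x)) \<longlongrightarrow> 0) (at x within A) \<longleftrightarrow>
      ((\<lambda>y. norm ((f y - f x) /\<^sub>R (y - x) - d)) \<longlongrightarrow> 0) (at x within A)"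
    by (intro filterlim_cong refl) (auto simp: eventually_at_filter)
  then show ?thesis
    unfolding has_vector_derivative_def has_derivative_iff_norm
    by (simp add: bounded_linear_scaleR_left tendsto_norm_zero_iff LIM_zero_iff)
qed

lemma has_vector_derivative_at_iff_left_right:
  fixes f :: "real \<Rightarrow> 'a::real_normed_vector"
  shows "(f has_vector_derivative d) (at x) \<longleftrightarrow>
    (f has_vector_derivative d) (at_left x) \<and> (f has_vector_derivative d) (at_right x)"
  unfolding has_vector_derivative_iff_quotient by (rule filterlim_at_split)

text \<open>Near \<open>a\<close> the map \<open>f r - r *\<^sub>R d\<close> has the small
  derivative \<open>D r - d\<close>, so the mean value inequality bounds its increment from
  \<open>a\<close>, which is \<open>s - a\<close> times the error of the difference
  quotient.\<close>

lemma has_vector_derivative_at_right_limit: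
  fixes f :: "real \<Rightarrow> 'a::real_normed_vector"
  assumes cont: "(f \<longlongrightarrow> f a) (at_right a)"
    and der: "\<forall>\<^sub>F s in at_right a. (f has_vector_derivative D s) (at s)"
    and lim: "(D \<longlongrightarrow> d) (at_right a)"
  shows "(f has_vector_derivative d) (at_right a)"
  unfolding has_vector_derivative_iff_quotient
proof (rule tendstoI)
  fix e :: real assume "e > 0"
  then have "\<forall>\<^sub>F s in at_right a. (f has_vector_derivative D s) (at s) \<and> dist (D s) d < e / 2"
    using der tendstoD[OF lim, of "e / 2"] by (auto intro: eventually_conj)
  then obtain b where "b > a"
    and b: "\<And>s. a < s \<Longrightarrow> s < b \<Longrightarrow> (f has_vector_derivative D s) (at s) \<and> dist (D s) d < e / 2"
    unfolding eventually_at_right_field by auto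
  have "dist ((f s - f a) /\<^sub>R (s - a)) d < e" if s: "a < s" "s < b" for s
  proof -
    \<comment> \<open>The mean value inequality wants continuity up to both endpoints: at
      \<open>a\<close> it comes from \<open>cont\<close>, elsewhere from differentiability.\<close>
    have "isCont f r" if "a < r" "r \<le> s" for r
      using b[of r] that s by (auto intro: has_vector_derivative_continuous)
    then have "continuous_on {a..s} f"
      using s cont by (intro continuous_on_IccI) (auto simp: continuous_at filterlim_at_split)
    then have "norm ((f s - s *\<^sub>R d) - (f a - a *\<^sub>R d)) \<le> e / 2 * s - e / 2 * a"
      using s b
      by (intro differentiable_bound_general[where f' = "\<lambda>r. D r - d" and \<phi>' = "\<lambda>_. e / 2"])
        (auto intro!: continuous_intros derivative_eq_intros less_imp_le simp: dist_norm
          has_real_derivative_iff_has_vector_derivative[symmetric])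
    also have "\<dots> = e / 2 * (s - a)"
      by (simp add: algebra_simps)
    also have "(f s - s *\<^sub>R d) - (f a - a *\<^sub>R d) = (s - a) *\<^sub>R ((f s - f a) /\<^sub>R (s - a) - d)"
      using s by (simp add: scaleR_diff_right scaleR_diff_left)
    finally have "norm ((f s - f a) /\<^sub>R (s - a) - d) \<le> e / 2"
      using s by (simp add: mult.commute[of _ "s - a"])
    then show ?thesis
      using \<open>e > 0\<close> by (simp add: dist_norm)
  qed
  then show "\<forall>\<^sub>F s in at_right a. dist ((f s - f a) /\<^sub>R (s - a)) d < e"
    unfolding eventually_at_right_field using \<open>b > a\<close> by auto
qed

section \<open>Uniform boundedness\<close>

text \<open>The sets where all \<open>F i\<close> are bounded by \<open>n\<close> are closed and
  cover the Banach space, so by Baire one of them contains a ball. Linearity moves this bound to a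
  ball about the origin.\<close>

theorem uniform_boundedness:
  fixes F :: "'i \<Rightarrow> 'a::banach \<Rightarrow>\<^sub>L 'b::real_normed_vector"
  assumes "\<And>x. \<exists>c. \<forall>i\<in>I. norm (F i x) \<le> c"
  shows "\<exists>M. \<forall>i\<in>I. norm (F i) \<le> M"
proof -
  define A where "A n = {x. \<forall>i\<in>I. norm (F i x) \<le> real n}" for n :: nat
  have closed: "closed (A n)" for n
    unfolding A_def Collect_ball_eq by (intro closed_INT ballI closed_Collect_le continuous_intros)
  have "x \<in> (\<Union>n. A n)" for x
  proof -
    obtain c where "\<forall>i\<in>I. norm (F i x) \<le> c"
      using assms by blast
    moreover obtain n where "c \<le> real n"
      using real_arch_simple by blast
    ultimately have "x \<in> A n"
      unfolding A_def by (blast intro: order_trans)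
    then show ?thesis
      by blast
  qed
  then have UN: "\<Union>(range A) = UNIV"
    by auto
  have "\<exists>n. interior (A n) \<noteq> {}"
  proof (rule ccontr)
    assume "\<nexists>n. interior (A n) \<noteq> {}"
    then have "euclidean interior_of \<Union>(range A) = {}"
      using closed by (intro Baire_category_alt) (auto simp: completely_metrizable_space_euclidean)
    then show False
      using UN by simp
  qed
  then obtain n x e where "e > 0" and ball: "cball x e \<subseteq> A n"
    by (metis ex_in_conv mem_interior_cball)
  \<comment> \<open>Rescaled to norm \<open>e\<close>, a vector is the difference of two points of
    the ball, and each of their images has norm at most \<open>n\<close>.\<close>
  have "norm (F i) \<le> 2 * real n / e" if i: "i \<in> I" for i
  proof (rule norm_blinfun_bound)
    fix y
    show "norm (F i y) \<le> 2 * real n / e * norm y"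
    proof (cases "y = 0")
      case False
      define z where "z = (e / norm y) *\<^sub>R y"
      have "norm z = e"
        using False \<open>e > 0\<close> by (simp add: z_def)
      then have "x + z \<in> A n" "x \<in> A n"
        using ball \<open>e > 0\<close> by (auto simp: subset_iff dist_norm)
      then have "norm (F i (x + z)) \<le> n" "norm (F i x) \<le> n"
        using i by (auto simp: A_def)
      moreover have "F i z = F i (x + z) - F i x"
        by (simp add: blinfun.bilinear_simps)
      ultimately have "norm (F i z) \<le> 2 * real n"
        using norm_triangle_ineq4[of "F i (x + z)" "F i x"] by simp
      moreover have "norm (F i z) = e / norm y * norm (F i y)"
        using \<open>e > 0\<close> by (simp add: z_def blinfun.scaleR_right)
      ultimately show ?thesis
        using False \<open>e > 0\<close> by (simp add: field_simps)
    qed simp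
  qed (use \<open>e > 0\<close> in simp)
  then show ?thesis
    by blast
qed

section \<open>Strongly continuous semigroups\<close>

lemma C0_semigroup_zero: "C0_semigroup T \<Longrightarrow> T 0 x = x"
  by (simp add: C0_semigroup_def)

lemma C0_semigroup_add:
  "C0_semigroup T \<Longrightarrow> r \<ge> 0 \<Longrightarrow> s \<ge> 0 \<Longrightarrow> T (r + s) x = T r (T s x)"
  by (simp add: C0_semigroup_def)

lemma C0_semigroup_tendsto: "C0_semigroup T \<Longrightarrow> ((\<lambda>s. T s x) \<longlongrightarrow> x) (at_right 0)"
  by (simp add: C0_semigroup_def)

text \<open>Otherwise some times \<open>t n\<close> tend to 0 with
  \<open>norm (T (t n)) > n\<close>. Strong continuity makes each sequence \<open>T (t n) x\<close>
  convergent, hence bounded, against uniform boundedness.\<close>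

lemma C0_semigroup_bounded_at_right_0:
  fixes T :: "real \<Rightarrow> 'a::banach \<Rightarrow>\<^sub>L 'a"
  assumes T: "C0_semigroup T"
  obtains M where "\<forall>\<^sub>F s in at_right 0. norm (T s) \<le> M"
proof -
  have "\<exists>M. \<forall>\<^sub>F s in at_right 0. norm (T s) \<le> M"
  proof (rule ccontr)
    assume unbdd: "\<nexists>M. \<forall>\<^sub>F s in at_right 0. norm (T s) \<le> M"
    have "\<exists>s>0. s < 1 / real (Suc n) \<and> norm (T s) > n" for n
    proof (rule ccontr)
      assume "\<not> ?thesis"
      then have "\<forall>s>0. s < 1 / real (Suc n) \<longrightarrow> norm (T s) \<le> n"
        by (meson not_less)
      moreover have "1 / real (Suc n) > 0"
        by simp
      ultimately have "\<forall>\<^sub>F s in at_right 0. norm (T s) \<le> n"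
        unfolding eventually_at_right_field by blast
      with unbdd show False
        by blast
    qed
    then obtain t where t: "\<And>n. t n > 0" "\<And>n. t n < 1 / real (Suc n)" "\<And>n. norm (T (t n)) > real n"
      by metis
    have "t \<longlonglongrightarrow> 0"
      by (rule tendsto_sandwich[OF _ _ tendsto_const LIMSEQ_inverse_real_of_nat])
        (use t(1,2) in \<open>auto intro!: always_eventually less_imp_le simp: inverse_eq_divide\<close>)
    then have "filterlim t (at_right 0) sequentially"
      using t(1) by (simp add: filterlim_at less_imp_neq[symmetric])
    then have "(\<lambda>n. T (t n) x) \<longlonglongrightarrow> x" for x
      using C0_semigroup_tendsto[OF T] by (rule filterlim_compose[rotated])
    then have "\<exists>c. \<forall>n\<in>UNIV. norm (T (t n) x) \<le> c" for x
      using convergent_imp_Bseq[of "\<lambda>n. T (t n) x"] by (auto simp: convergent_def Bseq_def)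
    then obtain M where "\<And>n. norm (T (t n)) \<le> M"
      using uniform_boundedness[of UNIV "\<lambda>n. T (t n)"] by auto
    moreover obtain n where "M \<le> real n"
      using real_arch_simple by blast
    ultimately show False
      using t(3)[of n] by (meson less_le_trans not_less order_trans)
  qed
  then show thesis
    using that by blast
qed

text \<open>For \<open>r\<close> just below \<open>s\<close>, the operator \<open>T r\<close>
  factors into a fixed \<open>T p\<close> and a \<open>T (r - p)\<close> with a time so short that
  the bound near 0 applies.\<close>

lemma C0_semigroup_bounded_at_left:
  fixes T :: "real \<Rightarrow> 'a::banach \<Rightarrow>\<^sub>L 'a"
  assumes T: "C0_semigroup T" and "s > 0"
  obtains M where "\<forall>\<^sub>F r in at_left s. norm (T r) \<le> M"
proof -
  obtain M where "\<forall>\<^sub>F q in at_right 0. norm (T q) \<le> M"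
    using C0_semigroup_bounded_at_right_0[OF T] .
  then obtain b where "b > 0" and b: "\<And>q. 0 < q \<Longrightarrow> q < b \<Longrightarrow> norm (T q) \<le> M"
    unfolding eventually_at_right_field by auto
  \<comment> \<open>The distance from \<open>p\<close> to \<open>s\<close> is at most
    \<open>b\<close>; the cut at 0 is there because the semigroup law holds for nonnegative times
    only.\<close>
  define p where "p = max 0 (s - b)"
  have p: "0 \<le> p" "p < s" "s - p \<le> b"
    using \<open>s > 0\<close> \<open>b > 0\<close> by (auto simp: p_def)
  have "norm (T r) \<le> M * norm (T p)" if "p < r" "r < s" for r
  proof -
    have "T r = T (r - p) o\<^sub>L T p"
      using T p that unfolding C0_semigroup_def by (metis diff_add_cancel diff_ge_0_iff_ge less_imp_le)
    then have "norm (T r) \<le> norm (T (r - p)) * norm (T p)"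
      by (simp add: norm_blinfun_compose)
    also have "\<dots> \<le> M * norm (T p)"
      using b[of "r - p"] p that by (intro mult_right_mono) auto
    finally show ?thesis .
  qed
  then have "\<forall>\<^sub>F r in at_left s. norm (T r) \<le> M * norm (T p)"
    using p unfolding eventually_at_left_field by auto
  then show thesis
    by (rule that)
qed

lemma tendsto_blinfun_apply_bounded_zero:
  fixes T :: "'c \<Rightarrow> 'a::real_normed_vector \<Rightarrow>\<^sub>L 'b::real_normed_vector"
  assumes bdd: "\<forall>\<^sub>F r in F. norm (T r) \<le> M" and "(g \<longlongrightarrow> 0) F"
  shows "((\<lambda>r. T r (g r)) \<longlongrightarrow> 0) F"
proof (rule Lim_null_comparison)
  show "\<forall>\<^sub>F r in F. norm (T r (g r)) \<le> M * norm (g r)"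
    using bdd by eventually_elim (meson norm_blinfun order_trans mult_right_mono norm_ge_zero)
  show "((\<lambda>r. M * norm (g r)) \<longlongrightarrow> 0) F"
    using tendsto_mult_right_zero[OF tendsto_norm_zero[OF assms(2)]] .
qed

text \<open>The semigroup law reduces quotients at \<open>s\<close> to quotients at 0. On the right
  the fixed operator \<open>T s\<close> factors out; on the left the factor \<open>T r\<close>
  varies with \<open>r\<close>, and a norm bound on it is needed.\<close>

lemma C0_semigroup_has_vector_derivative:
  fixes T :: "real \<Rightarrow> 'a::banach \<Rightarrow>\<^sub>L 'a"
  assumes T: "C0_semigroup T" and "s > 0"
    and gen: "((\<lambda>h. (T h x - x) /\<^sub>R h) \<longlongrightarrow> y) (at_right 0)"
  shows "((\<lambda>r. T r x) has_vector_derivative T s y) (at s)"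
  unfolding has_vector_derivative_at_iff_left_right
  unfolding has_vector_derivative_iff_quotient
proof
  have "((\<lambda>h. T s ((T h x - x) /\<^sub>R h)) \<longlongrightarrow> T s y) (at_right 0)"
    by (intro tendsto_intros gen)
  moreover have "\<forall>\<^sub>F h in at_right 0. T s ((T h x - x) /\<^sub>R h) = (T (h + s) x - T s x) /\<^sub>R (h + s - s)"
    using eventually_at_right_less[of 0]
    by eventually_elim (use \<open>s > 0\<close> in \<open>simp add: blinfun.bilinear_simps add.commute[of _ s] C0_semigroup_add[OF T]\<close>)
  ultimately show "((\<lambda>r. (T r x - T s x) /\<^sub>R (r - s)) \<longlongrightarrow> T s y) (at_right s)"
    by (subst filterlim_at_right_to_0) (rule Lim_transform_eventually)
next
  obtain M where M: "\<forall>\<^sub>F r in at_left s. norm (T r) \<le> M"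
    using C0_semigroup_bounded_at_left[OF T \<open>s > 0\<close>] .
  have shift: "filterlim (\<lambda>r. s - r) (at_right 0) (at_left s)"
    by (auto simp: filterlim_at eventually_at_filter intro!: tendsto_eq_intros)
  \<comment> \<open>Subtracting \<open>T h y\<close> instead of \<open>y\<close> pays off for
    \<open>h = s - r\<close>: \<open>T r\<close> maps it exactly to \<open>T s y\<close>, and the
    whole error is \<open>T r\<close> applied to a null function.\<close>
  have "((\<lambda>h. (T h x - x) /\<^sub>R h - T h y) \<longlongrightarrow> 0) (at_right 0)"
    using tendsto_diff[OF gen C0_semigroup_tendsto[OF T, of y]] by simp
  then have "((\<lambda>r. T r ((T (s - r) x - x) /\<^sub>R (s - r) - T (s - r) y)) \<longlongrightarrow> 0) (at_left s)"
    by (intro tendsto_blinfun_apply_bounded_zero[OF M] filterlim_compose[OF _ shift])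
  moreover have "\<forall>\<^sub>F r in at_left s. T r ((T (s - r) x - x) /\<^sub>R (s - r) - T (s - r) y) =
      (T r x - T s x) /\<^sub>R (r - s) - T s y"
  proof -
    have "T r ((T (s - r) x - x) /\<^sub>R (s - r) - T (s - r) y) = (T r x - T s x) /\<^sub>R (r - s) - T s y"
      if "0 < r" "r < s" for r
    proof -
      have "T r (T (s - r) z) = T s z" for z
        using C0_semigroup_add[OF T, of r "s - r"] that by simp
      moreover have "(T s x - T r x) /\<^sub>R (s - r) = (T r x - T s x) /\<^sub>R (r - s)"
        by (metis inverse_minus_eq minus_diff_eq scaleR_minus_left scaleR_minus_right minus_minus)
      ultimately show ?thesis
        by (simp add: blinfun.bilinear_simps)
    qed
    then show ?thesis
      unfolding eventually_at_left_field using \<open>s > 0\<close> by auto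
  qed
  ultimately have "((\<lambda>r. (T r x - T s x) /\<^sub>R (r - s) - T s y) \<longlongrightarrow> 0) (at_left s)"
    by (rule Lim_transform_eventually)
  then show "((\<lambda>r. (T r x - T s x) /\<^sub>R (r - s)) \<longlongrightarrow> T s y) (at_left s)"
    by (simp add: LIM_zero_iff)
qed

text \<open>\<open>Lim\<close> is meaningful only where the limit exists, so domain and value are
  handled together, as membership of the pair \<open>(x, y)\<close> in the graph.\<close>

lemma generator_iff:
  "x \<in> generator_dom T \<and> generator T x = y \<longleftrightarrow>
    ((\<lambda>s. (T s x - x) /\<^sub>R s) \<longlongrightarrow> y) (at_right 0)"
  unfolding generator_dom_def generator_def by (auto simp: tendsto_Lim)

section \<open>The conformable derivative and the change of time\<close>

lemma conf_deriv_eqI: "has_conf_derivative \<delta> v d t \<Longrightarrow> conf_deriv \<delta> v t = d"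
  unfolding conf_deriv_def has_conf_derivative_def by (blast intro: LIM_unique)

text \<open>The counterpart for the conformable graph. Any \<open>D\<close> that is eventually a
  derivative may replace the \<open>THE\<close> in \<open>conf_deriv\<close>, by uniqueness of
  limits.\<close>

lemma conf_generator_iff:
  "x \<in> conf_generator_dom \<delta> S \<and> conf_generator \<delta> S x = y \<longleftrightarrow>
    (\<exists>D. (\<forall>\<^sub>F t in at_right 0. has_conf_derivative \<delta> (\<lambda>u. S u x) (D t) t) \<and>
      (D \<longlongrightarrow> y) (at_right 0))"
proof
  assume x: "x \<in> conf_generator_dom \<delta> S \<and> conf_generator \<delta> S x = y"
  let ?D = "conf_deriv \<delta> (\<lambda>u. S u x)"
  have "\<forall>\<^sub>F t in at_right 0. conf_differentiable \<delta> (\<lambda>u. S u x) t"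
    using x by (simp add: conf_generator_dom_def)
  then have "\<forall>\<^sub>F t in at_right 0. has_conf_derivative \<delta> (\<lambda>u. S u x) (?D t) t"
    by eventually_elim (auto simp: conf_differentiable_def conf_deriv_eqI)
  moreover have "(?D \<longlongrightarrow> y) (at_right 0)"
    using x by (auto simp: conf_generator_dom_def conf_generator_def tendsto_Lim)
  ultimately show "\<exists>D. (\<forall>\<^sub>F t in at_right 0. has_conf_derivative \<delta> (\<lambda>u. S u x) (D t) t) \<and>
      (D \<longlongrightarrow> y) (at_right 0)"
    by blast
next
  assume "\<exists>D. (\<forall>\<^sub>F t in at_right 0. has_conf_derivative \<delta> (\<lambda>u. S u x) (D t) t) \<and>
      (D \<longlongrightarrow> y) (at_right 0)"
  then obtain D where D: "\<forall>\<^sub>F t in at_right 0. has_conf_derivative \<delta> (\<lambda>u. S u x) (D t) t"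
    and lim: "(D \<longlongrightarrow> y) (at_right 0)"
    by blast
  have "\<forall>\<^sub>F t in at_right 0. D t = conf_deriv \<delta> (\<lambda>u. S u x) t"
    using D by eventually_elim (simp add: conf_deriv_eqI)
  with lim have "(conf_deriv \<delta> (\<lambda>u. S u x) \<longlongrightarrow> y) (at_right 0)"
    by (rule Lim_transform_eventually)
  moreover have "\<forall>\<^sub>F t in at_right 0. conf_differentiable \<delta> (\<lambda>u. S u x) t"
    using D by eventually_elim (auto simp: conf_differentiable_def)
  ultimately show "x \<in> conf_generator_dom \<delta> S \<and> conf_generator \<delta> S x = y"
    by (auto simp: conf_generator_dom_def conf_generator_def tendsto_Lim)
qed

text \<open>Reads the conformable quotient as an ordinary one at \<open>h = 0\<close>, which opens
  the way to the chain rule.\<close>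

lemma has_conf_derivative_iff_affine:
  "has_conf_derivative \<delta> v d t \<longleftrightarrow>
    ((\<lambda>h. v (t + h * t powr (1 - \<delta>))) has_vector_derivative d) (at 0)"
  by (simp add: has_conf_derivative_def has_vector_derivative_iff_quotient)

text \<open>
  The time change \<open>s = t powr \<delta> / \<delta>\<close> has derivative \<open>t powr (\<delta> - 1)\<close>, which cancels the
  factor \<open>t powr (1 - \<delta>)\<close> of the conformable increment.
\<close>

lemma has_conf_derivative_iff_time_change:
  fixes u v :: "real \<Rightarrow> 'a::real_normed_vector"
  assumes "0 < \<delta>" and "s > 0"
    and uv: "\<And>r. r \<ge> 0 \<Longrightarrow> u r = v ((\<delta> * r) powr (1 / \<delta>))"
  shows "has_conf_derivative \<delta> v d ((\<delta> * s) powr (1 / \<delta>)) \<longleftrightarrow> (u has_vector_derivative d) (at s)"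
proof -
  define t where "t = (\<delta> * s) powr (1 / \<delta>)"
  define c where "c = t powr (1 - \<delta>)"
  have "t > 0" "c > 0"
    using assms by (auto simp: t_def c_def)
  have t_powr: "t powr \<delta> = \<delta> * s"
    using assms by (simp add: t_def powr_powr)
  \<comment> \<open>\<open>g\<close> leads from the increment \<open>h\<close> to semigroup time,
    and \<open>k\<close> leads back. Both have derivative 1 at the base point, so composing with
    either keeps the value \<open>d\<close>.\<close>
  define w where "w h = v (t + h * c)" for h
  define g where "g h = (t + h * c) powr \<delta> / \<delta>" for h
  define k where "k r = ((\<delta> * r) powr (1 / \<delta>) - t) / c" for r
  have "g 0 = s" "k s = 0"
    using assms t_powr by (auto simp: g_def k_def t_def)
  have "(g has_real_derivative 1) (at 0)"
    using assms \<open>t > 0\<close> unfolding g_def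
    by (auto intro!: derivative_eq_intros simp: c_def powr_add[symmetric])
  then have g: "(g has_vector_derivative 1) (at 0)"
    by (simp add: has_real_derivative_iff_has_vector_derivative)
  have "(\<delta> * s) powr (1 / \<delta> - 1) = c"
    using assms by (simp add: c_def t_def powr_powr diff_divide_distrib)
  then have "(k has_real_derivative 1) (at s)"
    using assms \<open>c > 0\<close> unfolding k_def
    by (auto intro!: derivative_eq_intros)
  then have k: "(k has_vector_derivative 1) (at s)"
    by (simp add: has_real_derivative_iff_has_vector_derivative)
  \<comment> \<open>These identities hold only where the powers have positive bases, which are open
    neighbourhoods of \<open>s\<close> and of 0; that suffices for derivatives.\<close>
  have wk: "w (k r) = u r" if "r > 0" for r
    using that \<open>c > 0\<close> uv[of r] by (simp add: w_def k_def)
  have ug: "u (g h) = w h" if "t + h * c > 0" for h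
    using that \<open>0 < \<delta>\<close> uv[of "g h"] by (simp add: w_def g_def powr_powr)
  have "(u has_vector_derivative d) (at s)" if "(w has_vector_derivative d) (at 0)"
  proof (rule has_vector_derivative_transform_within_open)
    show "(w \<circ> k has_vector_derivative d) (at s)"
      using vector_diff_chain_at[OF k, of w d] that \<open>k s = 0\<close> by simp
    show "open {0::real<..}" "s \<in> {0<..}"
      using \<open>s > 0\<close> by auto
  qed (simp add: wk)
  moreover have "(w has_vector_derivative d) (at 0)" if "(u has_vector_derivative d) (at s)"
  proof (rule has_vector_derivative_transform_within_open)
    show "(u \<circ> g has_vector_derivative d) (at 0)"
      using vector_diff_chain_at[OF g, of u d] that \<open>g 0 = s\<close> by simp
    show "open {h. t + h * c > 0}"
      by (intro open_Collect_less continuous_intros)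
    show "0 \<in> {h. t + h * c > 0}"
      using \<open>t > 0\<close> by simp
  qed (simp add: ug)
  ultimately show ?thesis
    unfolding has_conf_derivative_iff_affine t_def[symmetric] c_def[symmetric] w_def[symmetric]
    by blast
qed

lemma filterlim_powr_at_right_0:
  fixes f :: "real \<Rightarrow> real"
  assumes "filterlim f (at_right 0) F" and "a > 0"
  shows "filterlim (\<lambda>x. f x powr a) (at_right 0) F"
proof -
  have f: "(f \<longlongrightarrow> 0) F" "\<forall>\<^sub>F x in F. f x > 0"
    using assms(1) by (auto simp: filterlim_at elim: eventually_mono)
  have "((\<lambda>x. f x powr a) \<longlongrightarrow> 0) F"
    using f by (intro tendsto_zero_powrI[OF _ tendsto_const _ \<open>a > 0\<close>]) (auto elim: eventually_mono)
  moreover have "\<forall>\<^sub>F x in F. f x powr a > 0"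
    using f(2) by eventually_elim simp
  ultimately show ?thesis
    by (auto simp: filterlim_at elim: eventually_mono)
qed

lemma filterlim_mult_at_right_0:
  fixes c :: real
  assumes "c > 0"
  shows "filterlim (\<lambda>s. c * s) (at_right 0) (at_right 0)"
  using assms by (auto simp: filterlim_at eventually_at_filter intro!: tendsto_eq_intros)

text \<open>The conformable law at \<open>\<delta> * r\<close> and \<open>\<delta> * s\<close> is
  the additive law for \<open>T\<close>, and the time change tends to 0 from the right, so strong
  continuity carries over.\<close>

lemma C0_conf_semigroup_time_change:
  fixes S T :: "real \<Rightarrow> 'a::real_normed_vector \<Rightarrow>\<^sub>L 'a"
  assumes "0 < \<delta>" and S: "C0_conf_semigroup \<delta> S"
    and T: "\<And>s. s \<ge> 0 \<Longrightarrow> T s = S ((\<delta> * s) powr (1 / \<delta>))"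
  shows "C0_semigroup T"
  unfolding C0_semigroup_def
proof (intro conjI allI impI)
  show "T 0 = id_blinfun"
    using S T[of 0] by (simp add: C0_conf_semigroup_def conf_semigroup_def)
next
  fix r s :: real assume "r \<ge> 0" "s \<ge> 0"
  with assms show "T (r + s) = T r o\<^sub>L T s"
    by (simp add: C0_conf_semigroup_def conf_semigroup_def distrib_left)
next
  fix x
  have "filterlim (\<lambda>s. (\<delta> * s) powr (1 / \<delta>)) (at_right 0) (at_right 0)"
    using \<open>0 < \<delta>\<close> by (intro filterlim_powr_at_right_0 filterlim_mult_at_right_0) simp_all
  moreover have "((\<lambda>t. S t x) \<longlongrightarrow> x) (at_right 0)"
    using S by (simp add: C0_conf_semigroup_def)
  ultimately have "((\<lambda>s. S ((\<delta> * s) powr (1 / \<delta>)) x) \<longlongrightarrow> x) (at_right 0)"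
    by (rule filterlim_compose[rotated])
  moreover have "\<forall>\<^sub>F s in at_right 0. S ((\<delta> * s) powr (1 / \<delta>)) x = T s x"
    using eventually_at_right_less[of 0] by eventually_elim (simp add: T)
  ultimately show "((\<lambda>s. T s x) \<longlongrightarrow> x) (at_right 0)"
    by (rule Lim_transform_eventually)
qed

theorem theorem1:
  fixes S T :: "real \<Rightarrow> 'a::banach \<Rightarrow>\<^sub>L 'a" and \<delta> :: real
  assumes "0 < \<delta>" and "\<delta> \<le> 1"
    and "C0_conf_semigroup \<delta> S"
    and "\<And>s. s \<ge> 0 \<Longrightarrow> T s = S ((\<delta> * s) powr (1 / \<delta>))"
  shows "C0_semigroup T \<and>
         conf_generator_dom \<delta> S = generator_dom T \<and>
         (\<forall>x\<in>conf_generator_dom \<delta> S. conf_generator \<delta> S x = generator T x)"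
proof -
  have T: "C0_semigroup T"
    using assms(1,3,4) by (rule C0_conf_semigroup_time_change)
  \<comment> \<open>\<open>\<tau>\<close> turns semigroup time into conformable time, and
    \<open>\<sigma>\<close> goes back on positive times. Both preserve limits at 0 from the
    right.\<close>
  define \<tau> where "\<tau> s = (\<delta> * s) powr (1 / \<delta>)" for s :: real
  define \<sigma> where "\<sigma> t = inverse \<delta> * t powr \<delta>" for t :: real
  have \<tau>: "filterlim \<tau> (at_right 0) (at_right 0)"
    unfolding \<tau>_def using \<open>0 < \<delta>\<close>
    by (intro filterlim_powr_at_right_0 filterlim_mult_at_right_0) simp_all
  have \<sigma>: "filterlim \<sigma> (at_right 0) (at_right 0)"
    unfolding \<sigma>_def using \<open>0 < \<delta>\<close>
    by (intro filterlim_compose[OF filterlim_mult_at_right_0] filterlim_powr_at_right_0 filterlim_ident)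
      simp_all
  have \<tau>\<sigma>: "\<tau> (\<sigma> t) = t" if "t > 0" for t
    using that \<open>0 < \<delta>\<close> by (simp add: \<tau>_def \<sigma>_def powr_powr mult.assoc[symmetric])
  have deriv: "has_conf_derivative \<delta> (\<lambda>u. S u x) d (\<tau> s) \<longleftrightarrow>
      ((\<lambda>r. T r x) has_vector_derivative d) (at s)" if "s > 0" for s x d
    unfolding \<tau>_def using assms(1,4) that by (intro has_conf_derivative_iff_time_change) simp_all
  \<comment> \<open>Equality of the graphs gives at once that the domains and the values
    agree.\<close>
  have main: "x \<in> conf_generator_dom \<delta> S \<and> conf_generator \<delta> S x = y \<longleftrightarrow>
      x \<in> generator_dom T \<and> generator T x = y" for x y
    unfolding conf_generator_iff generator_iff
  proof
    assume "\<exists>D. (\<forall>\<^sub>F t in at_right 0. has_conf_derivative \<delta> (\<lambda>u. S u x) (D t) t) \<and>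
      (D \<longlongrightarrow> y) (at_right 0)"
    then obtain D where D: "\<forall>\<^sub>F t in at_right 0. has_conf_derivative \<delta> (\<lambda>u. S u x) (D t) t"
      and lim: "(D \<longlongrightarrow> y) (at_right 0)"
      by blast
    have "\<forall>\<^sub>F s in at_right 0. has_conf_derivative \<delta> (\<lambda>u. S u x) (D (\<tau> s)) (\<tau> s)"
      using D \<tau> by (rule eventually_compose_filterlim)
    then have "\<forall>\<^sub>F s in at_right 0. ((\<lambda>r. T r x) has_vector_derivative D (\<tau> s)) (at s)"
      using eventually_at_right_less[of 0] by eventually_elim (simp add: deriv)
    then have "((\<lambda>r. T r x) has_vector_derivative y) (at_right 0)"
      using T filterlim_compose[OF lim \<tau>]
      by (intro has_vector_derivative_at_right_limit)
        (simp_all add: C0_semigroup_zero C0_semigroup_tendsto)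
    then show "((\<lambda>s. (T s x - x) /\<^sub>R s) \<longlongrightarrow> y) (at_right 0)"
      using T by (simp add: has_vector_derivative_iff_quotient C0_semigroup_zero)
  next
    assume gen: "((\<lambda>s. (T s x - x) /\<^sub>R s) \<longlongrightarrow> y) (at_right 0)"
    \<comment> \<open>The orbit of \<open>x\<close> under \<open>T\<close> has derivative
      \<open>T (\<sigma> t) y\<close> at \<open>\<sigma> t\<close>, and
      \<open>\<tau> (\<sigma> t) = t\<close>. Strong continuity of \<open>T\<close> then yields the
      limit \<open>y\<close>.\<close>
    have "has_conf_derivative \<delta> (\<lambda>u. S u x) (T (\<sigma> t) y) t" if "t > 0" for t
    proof -
      have "\<sigma> t > 0"
        using that \<open>0 < \<delta>\<close> by (simp add: \<sigma>_def)
      then show ?thesis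
        using deriv[of "\<sigma> t"] C0_semigroup_has_vector_derivative[OF T _ gen] \<tau>\<sigma>[OF that] by metis
    qed
    then have "\<forall>\<^sub>F t in at_right 0. has_conf_derivative \<delta> (\<lambda>u. S u x) (T (\<sigma> t) y) t"
      by (rule eventually_mono[OF eventually_at_right_less])
    moreover have "((\<lambda>t. T (\<sigma> t) y) \<longlongrightarrow> y) (at_right 0)"
      using C0_semigroup_tendsto[OF T] \<sigma> by (rule filterlim_compose)
    ultimately show "\<exists>D. (\<forall>\<^sub>F t in at_right 0. has_conf_derivative \<delta> (\<lambda>u. S u x) (D t) t) \<and>
      (D \<longlongrightarrow> y) (at_right 0)"
      by (intro exI[of _ "\<lambda>t. T (\<sigma> t) y"] conjI)
  qed
  from main have "conf_generator_dom \<delta> S = generator_dom T"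
    by blast
  with T main show ?thesis
    by blast
qed

end
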